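(* Let $\mathcal{H}$ be a complex Hilbert space and let $A,B\in\mathbb{B}(\mathcal{H})$ be such that $B$ is positive. Then \[ \omega(AB)\le \frac32\,\|B\|\,\omega(A). \]
   Context: $\mathbb{B}(\mathcal{H})$ is the algebra of all bounded linear operators on $\mathcal{H}$. For $T\in\mathbb{B}(\mathcal{H})$, the numerical radius is $\omega(T)=\sup_{\|x\|=1}|\langle Tx,x\rangle|$ and the operator norm is $\|T\|=\sup_{\|x\|=1}\|Tx\|$. An operator $B\in\mathbb{B}(\mathcal{H})$ is positive if $\langle Bx,x\rangle\ge0$ for all $x\in\mathcal{H}$. *)

theory Defs
  imports "HOL-Analysis.Analysis"
begin

class complex_vector = real_vector +
  fixes scaleC :: "complex \<Rightarrow> 'a \<Rightarrow> 'a"  (infixr "*\<^sub>C" 75)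
  assumes scaleC_add_right: "c *\<^sub>C (x + y) = c *\<^sub>C x + c *\<^sub>C y"
    and scaleC_add_left: "(c + d) *\<^sub>C x = c *\<^sub>C x + d *\<^sub>C x"
    and scaleC_scaleC: "c *\<^sub>C d *\<^sub>C x = (c * d) *\<^sub>C x"
    and scaleC_one: "1 *\<^sub>C x = x"
    and scaleC_of_real: "complex_of_real r *\<^sub>C x = r *\<^sub>R x"

text \<open>The inner product is linear in the first argument and conjugate-linear in the second.\<close>

class complex_inner = complex_vector + real_normed_vector +
  fixes cinner :: "'a \<Rightarrow> 'a \<Rightarrow> complex"
  assumes cinner_commute: "cinner x y = cnj (cinner y x)"
    and cinner_add_left: "cinner (x + y) z = cinner x z + cinner y z"
    and cinner_scaleC_left: "cinner (c *\<^sub>C x) y = c * cinner x y"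
    and cinner_self_nonneg: "cinner x x \<in> \<real>\<^sub>\<ge>\<^sub>0"
    and cinner_eq_zero_iff: "cinner x x = 0 \<longleftrightarrow> x = 0"
    and norm_eq_sqrt_cinner: "norm x = sqrt (Re (cinner x x))"

class chilbert_space = complex_inner + complete_space

definition bounded_clinear :: "('a::complex_inner \<Rightarrow> 'b::complex_inner) \<Rightarrow> bool" where
  "bounded_clinear T \<longleftrightarrow> bounded_linear T \<and> (\<forall>c x. T (c *\<^sub>C x) = c *\<^sub>C T x)"

definition positive_operator :: "('a::complex_inner \<Rightarrow> 'a) \<Rightarrow> bool" where
  "positive_operator T \<longleftrightarrow> (\<forall>x. cinner (T x) x \<in> \<real>\<^sub>\<ge>\<^sub>0)"

text \<open>Inserting \<open>0\<close> matters only for the zero space, which has no unit vectors: it makes the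
  supremum \<open>0\<close> there, in agreement with the library's operator norm \<^const>\<open>onorm\<close>, whereas
  \<open>Sup {}\<close> is unspecified on the reals.\<close>

definition numerical_radius :: "('a::complex_inner \<Rightarrow> 'a) \<Rightarrow> real" where
  "numerical_radius T = Sup (insert 0 {cmod (cinner (T x) x) | x. norm x = 1})"

end

theory Submission
  imports Defs
begin

text \<open>
  Let \<open>b = \<parallel>B\<parallel>\<close>. The spectrum of the positive operator \<open>B\<close> lies in \<open>[0, b]\<close>; moving the midpoint
  of this interval to the origin, \<open>2 B = b I + C\<close> with \<open>C = 2 B - b I\<close> and \<open>\<parallel>C\<parallel> \<le> b\<close>. Hence
  \<open>2 \<langle>A B x, x\<rangle> = b \<langle>A x, x\<rangle> + \<langle>A C x, x\<rangle>\<close>. For a unit vector \<open>x\<close>, the first summand is at most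
  \<open>b \<omega>(A)\<close> in modulus. The second one is at most \<open>\<parallel>A\<parallel> \<parallel>C\<parallel> \<le> 2 \<omega>(A) b\<close>, because
  \<open>\<parallel>A\<parallel> \<le> 2 \<omega>(A)\<close>. The sum is \<open>3 b \<omega>(A)\<close>, and halving gives the constant \<open>3 / 2\<close>.

  The bound \<open>\<parallel>A\<parallel> \<le> 2 \<omega>(A)\<close> is the polarization identity combined with the parallelogram law
  (\<open>cinner_le_twice_numerical_radius\<close>). The bound \<open>\<parallel>C\<parallel> \<le> b\<close> amounts to \<open>\<parallel>B x\<parallel>\<^sup>2 \<le> b \<langle>B x, x\<rangle>\<close>;
  instead of spectral theory, it needs only the positivity of \<open>B\<close> at the single vector
  \<open>b x - B x\<close> (\<open>positive_operator_norm_square_le\<close>).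
\<close>

section \<open>Complex inner products\<close>

lemma cinner_add_right: "cinner x (y + z) = cinner x y + cinner x z"
  for x :: "'a::complex_inner"
  by (metis cinner_commute cinner_add_left complex_cnj_add)

lemma cinner_scaleC_right: "cinner x (c *\<^sub>C y) = cnj c * cinner x y"
  for x :: "'a::complex_inner"
  by (metis cinner_commute cinner_scaleC_left complex_cnj_mult)

lemma cinner_scaleR_left: "cinner (r *\<^sub>R x) y = of_real r * cinner x y"
  for x :: "'a::complex_inner"
  by (metis cinner_scaleC_left scaleC_of_real)

lemma cinner_scaleR_right: "cinner x (r *\<^sub>R y) = of_real r * cinner x y"
  for x :: "'a::complex_inner"
  by (metis cinner_scaleC_right scaleC_of_real complex_cnj_complex_of_real)

lemma cinner_minus_left: "cinner (- x) y = - cinner x y"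
  for x :: "'a::complex_inner"
  using cinner_scaleR_left[of "- 1" x y] by simp

lemma cinner_minus_right: "cinner x (- y) = - cinner x y"
  for x :: "'a::complex_inner"
  using cinner_scaleR_right[of x "- 1" y] by simp

lemma cinner_diff_left: "cinner (x - y) z = cinner x z - cinner y z"
  for x :: "'a::complex_inner"
  using cinner_add_left[of x "- y" z] by (simp add: cinner_minus_left)

lemma cinner_diff_right: "cinner x (y - z) = cinner x y - cinner x z"
  for x :: "'a::complex_inner"
  using cinner_add_right[of x y "- z"] by (simp add: cinner_minus_right)

lemmas cinner_simps =
  cinner_add_left cinner_add_right cinner_diff_left cinner_diff_right
  cinner_minus_left cinner_minus_right
  cinner_scaleC_left cinner_scaleC_right cinner_scaleR_left cinner_scaleR_right

lemma cinner_self: "cinner x x = of_real ((norm x)\<^sup>2)"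
  for x :: "'a::complex_inner"
proof -
  obtain r where "0 \<le> r" "cinner x x = of_real r"
    using cinner_self_nonneg[of x] by (auto elim: nonneg_Reals_cases)
  then show ?thesis by (simp add: norm_eq_sqrt_cinner)
qed

lemma norm_square_eq_Re_cinner: "(norm x)\<^sup>2 = Re (cinner x x)"
  for x :: "'a::complex_inner"
  by (simp add: cinner_self)

lemma norm_scaleC: "norm (c *\<^sub>C x) = cmod c * norm x"
  for x :: "'a::complex_inner"
proof -
  have "cinner (c *\<^sub>C x) (c *\<^sub>C x) = of_real ((cmod c * norm x)\<^sup>2)"
    unfolding cinner_scaleC_left cinner_scaleC_right cinner_self[of x]
    by (simp only: power_mult_distrib of_real_mult complex_norm_square[of c] ac_simps)
  then have "(norm (c *\<^sub>C x))\<^sup>2 = (cmod c * norm x)\<^sup>2"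
    by (simp only: norm_square_eq_Re_cinner Re_complex_of_real)
  then show ?thesis by (simp add: power2_eq_iff_nonneg)
qed

lemma parallelogram_law:
  "(norm (x + y))\<^sup>2 + (norm (x - y))\<^sup>2 = 2 * (norm x)\<^sup>2 + 2 * (norm y)\<^sup>2"
  for x :: "'a::complex_inner"
  by (simp add: norm_square_eq_Re_cinner cinner_simps)

text \<open>The norm satisfies the triangle inequality by hypothesis, and comparing squares in
  \<open>\<parallel>x + y\<parallel> \<le> \<parallel>x\<parallel> + \<parallel>y\<parallel>\<close> bounds the real part; rotating \<open>x\<close> by a phase turns the real part
  into the modulus.\<close>

lemma cmod_cinner_le: "cmod (cinner x y) \<le> norm x * norm y"
  for x :: "'a::complex_inner"
proof -
  have Re_le: "Re (cinner u v) \<le> norm u * norm v" for u v :: 'a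
  proof -
    have "(norm (u + v))\<^sup>2 \<le> (norm u + norm v)\<^sup>2"
      by (intro power_mono norm_triangle_ineq) simp
    moreover have "(norm (u + v))\<^sup>2 = (norm u)\<^sup>2 + (norm v)\<^sup>2 + 2 * Re (cinner u v)"
      using cinner_commute[of v u] by (simp add: norm_square_eq_Re_cinner cinner_simps)
    ultimately show ?thesis by (simp add: power2_sum)
  qed
  show ?thesis
  proof (cases "cinner x y = 0")
    case False
    define c where "c = cnj (sgn (cinner x y))"
    have "cmod c = 1" using False by (simp add: c_def norm_sgn)
    have "cinner (c *\<^sub>C x) y = of_real (cmod (cinner x y))"
      using False
      by (simp add: c_def sgn_eq cinner_simps complex_norm_square[symmetric] power2_eq_square
          mult.commute[of "cnj _"])
    then have "cmod (cinner x y) = Re (cinner (c *\<^sub>C x) y)" by simp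
    also have "\<dots> \<le> norm (c *\<^sub>C x) * norm y" by (rule Re_le)
    finally show ?thesis by (simp add: norm_scaleC \<open>cmod c = 1\<close>)
  qed simp
qed

section \<open>The numerical radius and the operator norm\<close>

lemma cmod_cinner_apply_le:
  fixes T :: "'a::complex_inner \<Rightarrow> 'a"
  assumes "bounded_linear T"
  shows "cmod (cinner (T x) x) \<le> onorm T * (norm x)\<^sup>2"
proof -
  have "cmod (cinner (T x) x) \<le> norm (T x) * norm x" by (rule cmod_cinner_le)
  also have "\<dots> \<le> (onorm T * norm x) * norm x"
    by (intro mult_right_mono onorm assms) simp
  finally show ?thesis by (simp add: power2_eq_square mult.assoc)
qed

lemma bdd_above_numerical_range:
  fixes T :: "'a::complex_inner \<Rightarrow> 'a"
  assumes "bounded_linear T"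
  shows "bdd_above (insert 0 {cmod (cinner (T x) x) | x. norm x = 1})"
proof (rule bdd_aboveI)
  fix r assume "r \<in> insert 0 {cmod (cinner (T x) x) | x. norm x = 1}"
  then show "r \<le> onorm T"
    using cmod_cinner_apply_le[OF assms] onorm_pos_le[OF assms]
    by (auto, metis mult.right_neutral power_one)
qed

lemma numerical_radius_nonneg:
  fixes T :: "'a::complex_inner \<Rightarrow> 'a"
  assumes "bounded_linear T"
  shows "0 \<le> numerical_radius T"
  unfolding numerical_radius_def
  by (intro cSup_upper bdd_above_numerical_range assms) simp

lemma cmod_cinner_le_numerical_radius:
  fixes T :: "'a::complex_inner \<Rightarrow> 'a"
  assumes "bounded_linear T"
  shows "cmod (cinner (T x) x) \<le> numerical_radius T * (norm x)\<^sup>2"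
proof (cases "x = 0")
  case True
  then show ?thesis using cmod_cinner_le[of "T x" x] by simp
next
  case False
  define u where "u = x /\<^sub>R norm x"
  have "norm u = 1" using False by (simp add: u_def)
  have x: "x = norm x *\<^sub>R u" using False by (simp add: u_def)
  have "cmod (cinner (T u) u) \<le> numerical_radius T"
    unfolding numerical_radius_def using \<open>norm u = 1\<close>
    by (intro cSup_upper bdd_above_numerical_range assms) auto
  moreover have "T x = norm x *\<^sub>R T u"
    by (subst x) (simp add: linear_scale[OF bounded_linear.linear[OF assms]])
  then have "cinner (T x) x = of_real ((norm x)\<^sup>2) * cinner (T u) u"
    by (subst (2) x) (simp add: cinner_simps power2_eq_square)
  then have "cmod (cinner (T x) x) = (norm x)\<^sup>2 * cmod (cinner (T u) u)"
    by (simp add: norm_mult norm_power)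
  ultimately show ?thesis by (simp add: mult.commute mult_right_mono)
qed

lemma numerical_radius_le:
  assumes "0 \<le> M" and "\<And>x. norm x = 1 \<Longrightarrow> cmod (cinner (T x) x) \<le> M"
  shows "numerical_radius T \<le> M"
  unfolding numerical_radius_def using assms by (intro cSup_least) auto

lemma bounded_clinear_imp_linear: "bounded_clinear T \<Longrightarrow> linear T"
  by (simp add: bounded_clinear_def bounded_linear.linear)

lemma bounded_clinear_expand:
  assumes "bounded_clinear T"
  shows "cinner (T (x + c *\<^sub>C y)) (x + c *\<^sub>C y) =
    cinner (T x) x + cnj c * cinner (T x) y + c * cinner (T y) x + c * cnj c * cinner (T y) y"
proof -
  have "T (x + c *\<^sub>C y) = T x + c *\<^sub>C T y"
    using assms linear_add[OF bounded_clinear_imp_linear[OF assms]]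
    by (simp add: bounded_clinear_def)
  then show ?thesis by (simp add: cinner_simps algebra_simps)
qed

lemma polarization_identity:
  assumes "bounded_clinear T"
  defines "q \<equiv> \<lambda>z. cinner (T z) z"
  shows "4 * cinner (T x) y =
    q (x + y) - q (x - y) + \<i> * q (x + \<i> *\<^sub>C y) - \<i> * q (x - \<i> *\<^sub>C y)"
proof -
  have neg: "(- c) *\<^sub>C z = - (c *\<^sub>C z)" for c and z :: 'a
    using scaleC_scaleC[of "- 1" c z] scaleC_of_real[of "- 1" "c *\<^sub>C z"] by simp
  have e: "q (x + c *\<^sub>C y) =
      q x + cnj c * cinner (T x) y + c * cinner (T y) x + c * cnj c * q y" for c
    unfolding q_def by (rule bounded_clinear_expand[OF assms(1)])
  have q1: "q (x + y) = q x + cinner (T x) y + cinner (T y) x + q y"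
    using e[of 1] by (simp add: scaleC_one)
  have q2: "q (x - y) = q x - cinner (T x) y - cinner (T y) x + q y"
    using e[of "- 1"] by (simp add: neg scaleC_one)
  have q3: "q (x + \<i> *\<^sub>C y) = q x - \<i> * cinner (T x) y + \<i> * cinner (T y) x + q y"
    using e[of "\<i>"] by simp
  have q4: "q (x - \<i> *\<^sub>C y) = q x + \<i> * cinner (T x) y - \<i> * cinner (T y) x + q y"
    using e[of "- \<i>"] by (simp add: neg)
  show ?thesis unfolding q1 q2 q3 q4 by (simp add: algebra_simps)
qed

text \<open>For unit vectors, each of the four terms of the polarization identity is bounded through the
  numerical radius, and by the parallelogram law the squared norms of their arguments add up
  to \<open>8\<close>.\<close>

lemma cinner_le_twice_numerical_radius:
  assumes "bounded_clinear T"
  shows "cmod (cinner (T x) y) \<le> 2 * numerical_radius T * norm x * norm y"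
proof -
  have bl: "bounded_linear T" using assms by (simp add: bounded_clinear_def)
  let ?w = "numerical_radius T"
  have unit: "cmod (cinner (T u) v) \<le> 2 * ?w" if "norm u = 1" "norm v = 1" for u v
  proof -
    define q where "q = (\<lambda>z. cinner (T z) z)"
    have q: "cmod (q z) \<le> ?w * (norm z)\<^sup>2" for z
      unfolding q_def by (rule cmod_cinner_le_numerical_radius[OF bl])
    have "4 * cmod (cinner (T u) v) = cmod (4 * cinner (T u) v)"
      by (simp add: norm_mult)
    also have "\<dots> = cmod (q (u + v) - q (u - v) + \<i> * q (u + \<i> *\<^sub>C v) - \<i> * q (u - \<i> *\<^sub>C v))"
      unfolding q_def by (simp only: polarization_identity[OF assms])
    also have "\<dots> \<le> cmod (q (u + v)) + cmod (q (u - v))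
        + cmod (\<i> * q (u + \<i> *\<^sub>C v)) + cmod (\<i> * q (u - \<i> *\<^sub>C v))"
      by (intro norm_triangle_le_diff norm_triangle_le add_mono order_refl)
    also have "\<dots> \<le> ?w * (norm (u + v))\<^sup>2 + ?w * (norm (u - v))\<^sup>2
        + ?w * (norm (u + \<i> *\<^sub>C v))\<^sup>2 + ?w * (norm (u - \<i> *\<^sub>C v))\<^sup>2"
      using q by (intro add_mono) (simp_all add: norm_mult)
    also have "\<dots> = ?w * (((norm (u + v))\<^sup>2 + (norm (u - v))\<^sup>2)
        + ((norm (u + \<i> *\<^sub>C v))\<^sup>2 + (norm (u - \<i> *\<^sub>C v))\<^sup>2))"
      by (simp add: algebra_simps)
    also have "\<dots> = 8 * ?w"
      using that by (simp only: parallelogram_law norm_scaleC) simp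
    finally show ?thesis by simp
  qed
  show ?thesis
  proof (cases "x = 0 \<or> y = 0")
    case True
    then show ?thesis
      using cmod_cinner_le[of "T x" y] linear_0[OF bounded_clinear_imp_linear[OF assms]] by auto
  next
    case False
    define u where "u = x /\<^sub>R norm x"
    define v where "v = y /\<^sub>R norm y"
    have "norm u = 1" "norm v = 1" using False by (simp_all add: u_def v_def)
    have x: "x = norm x *\<^sub>R u" and y: "y = norm y *\<^sub>R v"
      using False by (simp_all add: u_def v_def)
    have "T x = norm x *\<^sub>R T u"
      by (subst x) (simp add: linear_scale[OF bounded_clinear_imp_linear[OF assms]])
    then have "cinner (T x) y = of_real (norm x * norm y) * cinner (T u) v"
      by (subst y) (simp add: cinner_simps)
    then have "cmod (cinner (T x) y) = (norm x * norm y) * cmod (cinner (T u) v)"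
      by (simp add: norm_mult)
    also have "\<dots> \<le> (norm x * norm y) * (2 * ?w)"
      using unit[OF \<open>norm u = 1\<close> \<open>norm v = 1\<close>] by (intro mult_left_mono) simp_all
    finally show ?thesis by (simp add: algebra_simps)
  qed
qed

section \<open>Positive operators\<close>

text \<open>Over the complex numbers a real quadratic form has a hermitian sesquilinear form: that
  \<open>\<langle>B z, z\<rangle>\<close> is real at \<open>z = x + y\<close> makes the imaginary parts of \<open>\<langle>B x, y\<rangle>\<close> and \<open>\<langle>B y, x\<rangle>\<close>
  opposite, and at \<open>z = x + \<i> y\<close> it makes their real parts equal.\<close>

lemma positive_operator_self_adjoint:
  assumes "bounded_clinear B" and "positive_operator B"
  shows "cinner (B x) y = cinner x (B y)"
proof -
  have real: "Im (cinner (B z) z) = 0" for z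
    using assms(2) by (simp add: positive_operator_def complex_nonneg_Reals_iff)
  have "Im (cinner (B x) y) + Im (cinner (B y) x) = 0"
    using arg_cong[OF bounded_clinear_expand[OF assms(1), of x 1 y], of Im] by (simp add: real)
  moreover have "Re (cinner (B y) x) = Re (cinner (B x) y)"
    using arg_cong[OF bounded_clinear_expand[OF assms(1), of x "\<i>" y], of Im] by (simp add: real)
  ultimately have "cinner (B x) y = cnj (cinner (B y) x)" by (simp add: complex_eq_iff)
  then show ?thesis by (metis cinner_commute)
qed

text \<open>This is \<open>B\<^sup>2 \<le> \<parallel>B\<parallel> B\<close>. Positivity at \<open>z = b x - B x\<close> gives
  \<open>0 \<le> b\<^sup>2 \<langle>B x, x\<rangle> - 2 b \<parallel>B x\<parallel>\<^sup>2 + \<langle>B (B x), B x\<rangle>\<close>, where the last term is at most \<open>b \<parallel>B x\<parallel>\<^sup>2\<close>;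
  cancelling one factor \<open>b\<close> leaves the claim.\<close>

lemma positive_operator_norm_square_le:
  assumes "bounded_clinear B" and "positive_operator B"
  shows "(norm (B x))\<^sup>2 \<le> onorm B * Re (cinner (B x) x)"
proof -
  have bl: "bounded_linear B" using assms(1) by (simp add: bounded_clinear_def)
  define b where "b = onorm B"
  have "0 \<le> b" unfolding b_def by (rule onorm_pos_le[OF bl])
  define z where "z = b *\<^sub>R x - B x"
  have Bz: "B z = b *\<^sub>R B x - B (B x)"
    unfolding z_def using bounded_linear.linear[OF bl] by (simp add: linear_diff linear_scale)
  have "0 \<le> Re (cinner (B z) z)"
    using assms(2) by (simp add: positive_operator_def complex_nonneg_Reals_iff)
  also have "Re (cinner (B z) z) =
      b\<^sup>2 * Re (cinner (B x) x) - 2 * b * (norm (B x))\<^sup>2 + Re (cinner (B (B x)) (B x))"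
    unfolding Bz unfolding z_def norm_square_eq_Re_cinner
    by (simp add: cinner_simps
        positive_operator_self_adjoint[OF assms, of "B x" x] power2_eq_square algebra_simps)
  finally have "0 \<le> b\<^sup>2 * Re (cinner (B x) x) - 2 * b * (norm (B x))\<^sup>2
      + Re (cinner (B (B x)) (B x))" .
  moreover have "Re (cinner (B (B x)) (B x)) \<le> b * (norm (B x))\<^sup>2"
    using complex_Re_le_cmod cmod_cinner_apply_le[OF bl] unfolding b_def by (rule order_trans)
  ultimately have "b * (norm (B x))\<^sup>2 \<le> b * (b * Re (cinner (B x) x))"
    by (simp add: power2_eq_square)
  show ?thesis
  proof (cases "b = 0")
    case True
    then have "B x = 0" using onorm[OF bl, of x] by (simp add: b_def)
    then show ?thesis using True by (simp add: b_def)
  next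
    case False
    then show ?thesis
      using \<open>0 \<le> b\<close> \<open>b * (norm (B x))\<^sup>2 \<le> b * (b * Re (cinner (B x) x))\<close>
      by (simp add: b_def)
  qed
qed

text \<open>Expanding the square, \<open>\<parallel>2 B x - b x\<parallel>\<^sup>2 - b\<^sup>2 \<parallel>x\<parallel>\<^sup>2 = 4 (\<parallel>B x\<parallel>\<^sup>2 - b \<langle>B x, x\<rangle>)\<close>, which is not
  positive by the preceding lemma.\<close>

lemma positive_operator_centred_norm_le:
  assumes "bounded_clinear B" and "positive_operator B"
  shows "norm (2 *\<^sub>R B x - onorm B *\<^sub>R x) \<le> onorm B * norm x"
proof -
  define b where "b = onorm B"
  have "0 \<le> b"
    unfolding b_def using assms(1) by (intro onorm_pos_le) (simp add: bounded_clinear_def)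
  have sym: "Re (cinner x (B x)) = Re (cinner (B x) x)"
    using positive_operator_self_adjoint[OF assms, of x x] by simp
  have "(norm (2 *\<^sub>R B x - b *\<^sub>R x))\<^sup>2 =
      4 * ((norm (B x))\<^sup>2 - b * Re (cinner (B x) x)) + (b * norm x)\<^sup>2"
    unfolding power_mult_distrib norm_square_eq_Re_cinner
    by (simp add: cinner_simps sym power2_eq_square algebra_simps)
  also have "\<dots> \<le> (b * norm x)\<^sup>2"
    using positive_operator_norm_square_le[OF assms, of x] by (simp add: b_def)
  finally show ?thesis
    using \<open>0 \<le> b\<close> by (auto simp: b_def intro: power2_le_imp_le)
qed

section \<open>Products with a positive operator\<close>

theorem corollary3p3:
  fixes A B :: "'a::chilbert_space \<Rightarrow> 'a"
  assumes "bounded_clinear A"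
    and "bounded_clinear B"
    and "positive_operator B"
  shows "numerical_radius (A \<circ> B) \<le> 3 / 2 * onorm B * numerical_radius A"
proof (rule numerical_radius_le)
  have blA: "bounded_linear A" and blB: "bounded_linear B"
    using assms by (simp_all add: bounded_clinear_def)
  let ?b = "onorm B" and ?w = "numerical_radius A"
  have "0 \<le> ?b" by (rule onorm_pos_le[OF blB])
  have "0 \<le> ?w" by (rule numerical_radius_nonneg[OF blA])
  show "0 \<le> 3 / 2 * ?b * ?w" using \<open>0 \<le> ?b\<close> \<open>0 \<le> ?w\<close> by simp
  fix x :: 'a assume "norm x = 1"
  define C where "C = 2 *\<^sub>R B x - ?b *\<^sub>R x"
  have "norm C \<le> ?b"
    using positive_operator_centred_norm_le[OF assms(2,3), of x] \<open>norm x = 1\<close> by (simp add: C_def)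
  have "2 *\<^sub>R A (B x) = ?b *\<^sub>R A x + A C"
    unfolding C_def using bounded_linear.linear[OF blA] by (simp add: linear_diff linear_scale)
  then have "2 * cinner (A (B x)) x = of_real ?b * cinner (A x) x + cinner (A C) x"
    by (metis cinner_scaleR_left cinner_add_left of_real_numeral)
  then have "2 * cmod (cinner (A (B x)) x) = cmod (of_real ?b * cinner (A x) x + cinner (A C) x)"
    by (metis norm_mult norm_numeral)
  also have "\<dots> \<le> ?b * cmod (cinner (A x) x) + cmod (cinner (A C) x)"
    using norm_triangle_ineq[of "of_real ?b * cinner (A x) x" "cinner (A C) x"] \<open>0 \<le> ?b\<close>
    by (simp add: norm_mult)
  also have "\<dots> \<le> ?b * ?w + 2 * ?w * ?b"
  proof (rule add_mono)
    show "?b * cmod (cinner (A x) x) \<le> ?b * ?w"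
      using cmod_cinner_le_numerical_radius[OF blA, of x] \<open>norm x = 1\<close> \<open>0 \<le> ?b\<close>
      by (simp add: mult_left_mono)
    have "cmod (cinner (A C) x) \<le> 2 * ?w * norm C"
      using cinner_le_twice_numerical_radius[OF assms(1), of C x] \<open>norm x = 1\<close> by simp
    also have "\<dots> \<le> 2 * ?w * ?b"
      using \<open>norm C \<le> ?b\<close> \<open>0 \<le> ?w\<close> by (intro mult_left_mono) simp_all
    finally show "cmod (cinner (A C) x) \<le> 2 * ?w * ?b" .
  qed
  finally show "cmod (cinner ((A \<circ> B) x) x) \<le> 3 / 2 * ?b * ?w"
    by (simp add: algebra_simps)
qed

end
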